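(* Let $X$ be a compact metric space, let $r:X\to X$ be a Borel measurable map which is onto and finite-to-one (i.e. $0<\#r^{-1}(x)<\infty$ for all $x\in X$), let $\mu$ be a strongly invariant measure on $X$, and let $m_0\in L^\infty(X)$ be a QMF filter. Suppose that $r:(X,\mu)\to(X,\mu)$ is ergodic, that $|m_0|$ is not constantly equal to $1$ $\mu$-a.e., that $m_0$ is non-singular, i.e. $\mu(\{x\in X : m_0(x)=0\})=0$, and that $\log|m_0|^2\in L^1(X)$. Then the wavelet representation $(\mathcal{H},U,\pi,\varphi)$ associated to $m_0$ is reducible.
   Context: $L^p(X)$ denotes $L^p(X,\mu)$. A Borel measure $\mu$ on $X$ is strongly invariant (for $r$) if $$\int_X f\,d\mu=\int_X\frac{1}{\#r^{-1}(x)}\sum_{r(y)=x}f(y)\,d\mu(x)\quad\text{for all } f\in L^\infty(X)$$ (in particular constants are integrable, so $\mu$ is finite). A function $m_0\in L^\infty(X)$ is a QMF filter if $\frac{1}{\#r^{-1}(x)}\sum_{r(y)=x}|m_0(y)|^2=1$ for $\mu$-a.e. $x\in X$. The wavelet representation associated to $m_0$ is the quadruple $(\mathcal{H},U,\pi,\varphi)$ consisting of a Hilbert space $\mathcal{H}$, a unitary operator $U$ on $\mathcal{H}$, a ($*$-)representation $\pi$ of $L^\infty(X)$ on $\mathcal{H}$ and an element $\varphi\in\mathcal{H}$ such that: (1) (covariance) $U\pi(f)U^{-1}=\pi(f\circ r)$ for all $f\in L^\infty(X)$; (2) (scaling equation) $U\varphi=\pi(m_0)\varphi$; (3) (orthogonality)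 $\langle\pi(f)\varphi,\varphi\rangle=\int_X f\,d\mu$ for all $f\in L^\infty(X)$; (4) (density) $\{U^{-n}\pi(f)\varphi : n\in\mathbb{N},\ f\in L^\infty(X)\}$ is dense in $\mathcal{H}$. Such a quadruple is known to exist and to be unique up to isomorphism (unitary equivalence). The representation is irreducible if the only closed subspaces of $\mathcal{H}$ invariant under $U$, $U^{-1}$ and all $\pi(f)$, $f\in L^\infty(X)$, are $\{0\}$ and $\mathcal{H}$ (equivalently, the commutant of $\{U,\pi(f): f\in L^\infty(X)\}$ is $\mathbb{C}I$); otherwise it is reducible. *)

theory Defs
  imports "HOL-Analysis.Analysis"
begin

text \<open>
  Complex Hilbert spaces, layered over the library's real inner product spaces: the real inner
  product is the real part of the complex one, so \<open>norm v\<close> is the usual Hilbert space norm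
  by \<open>norm_eq_sqrt_inner\<close>.  The inner product is linear in the first argument.
\<close>

class chilbert_space = real_inner + complete_space +
  fixes scaleC :: "complex \<Rightarrow> 'a \<Rightarrow> 'a" (infixr "*\<^sub>C" 75)
    and cinner :: "'a \<Rightarrow> 'a \<Rightarrow> complex"
  assumes scaleC_add_right: "a *\<^sub>C (x + y) = a *\<^sub>C x + a *\<^sub>C y"
    and scaleC_add_left: "(a + b) *\<^sub>C x = a *\<^sub>C x + b *\<^sub>C x"
    and scaleC_scaleC: "a *\<^sub>C (b *\<^sub>C x) = (a * b) *\<^sub>C x"
    and scaleC_of_real: "complex_of_real t *\<^sub>C x = t *\<^sub>R x"
    and cinner_commute: "cinner x y = cnj (cinner y x)"
    and cinner_add_left: "cinner (x + y) z = cinner x z + cinner y z"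
    and cinner_scaleC_left: "cinner (a *\<^sub>C x) y = a * cinner x y"
    and Re_cinner: "Re (cinner x y) = inner x y"

definition bounded_clinear :: "('h::chilbert_space \<Rightarrow> 'h) \<Rightarrow> bool" where
  "bounded_clinear T \<longleftrightarrow> bounded_linear T \<and> (\<forall>c v. T (c *\<^sub>C v) = c *\<^sub>C T v)"

definition unitary_op :: "('h::chilbert_space \<Rightarrow> 'h) \<Rightarrow> bool" where
  "unitary_op U \<longleftrightarrow> bounded_clinear U \<and> surj U \<and> (\<forall>v w. cinner (U v) (U w) = cinner v w)"

definition closed_csubspace :: "'h::chilbert_space set \<Rightarrow> bool" where
  "closed_csubspace K \<longleftrightarrow> closed K \<and> 0 \<in> K \<and>
     (\<forall>v\<in>K. \<forall>w\<in>K. v + w \<in> K) \<and> (\<forall>c. \<forall>v\<in>K. c *\<^sub>C v \<in> K)"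

text \<open>
  Representatives of the elements of \<open>L\<^sup>\<infinity>\<close>; almost everywhere equal functions are not
  identified here, so maps defined on \<open>L\<^sup>\<infinity>\<close> are required to respect that relation.
\<close>

definition L_infinity :: "'a measure \<Rightarrow> ('a \<Rightarrow> complex) set" where
  "L_infinity M = {f. f \<in> borel_measurable M \<and> (\<exists>C. AE x in M. norm (f x) \<le> C)}"

definition fibre_avg :: "('a \<Rightarrow> 'a) \<Rightarrow> ('a \<Rightarrow> 'b::field) \<Rightarrow> 'a \<Rightarrow> 'b" where
  "fibre_avg r f x = 1 / of_nat (card (r -` {x})) * (\<Sum>y\<in>r -` {x}. f y)"

text \<open>
  Existence of the integral of the fibre average is spelled out, because \<open>integral\<^sup>L\<close> is 0 by
  convention for functions that are not integrable.
\<close>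

definition strongly_invariant :: "('a \<Rightarrow> 'a) \<Rightarrow> 'a measure \<Rightarrow> bool" where
  "strongly_invariant r M \<longleftrightarrow> finite_measure M \<and>
     (\<forall>f\<in>L_infinity M. integrable M (fibre_avg r f) \<and>
        (\<integral>x. f x \<partial>M) = (\<integral>x. fibre_avg r f x \<partial>M))"

definition qmf_filter :: "('a \<Rightarrow> 'a) \<Rightarrow> 'a measure \<Rightarrow> ('a \<Rightarrow> complex) \<Rightarrow> bool" where
  "qmf_filter r M m \<longleftrightarrow> m \<in> L_infinity M \<and>
     (AE x in M. fibre_avg r (\<lambda>y. (cmod (m y))\<^sup>2) x = 1)"

definition ergodic_map :: "'a measure \<Rightarrow> ('a \<Rightarrow> 'a) \<Rightarrow> bool" where
  "ergodic_map M T \<longleftrightarrow> T \<in> measurable M M \<and> distr M M T = M \<and>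
     (\<forall>A\<in>sets M. T -` A \<inter> space M = A \<longrightarrow> A \<in> null_sets M \<or> space M - A \<in> null_sets M)"

text \<open>
  Unitality is not demanded of a representation; for a wavelet representation it follows from
  covariance and density.
\<close>

definition star_rep :: "'a measure \<Rightarrow> (('a \<Rightarrow> complex) \<Rightarrow> 'h::chilbert_space \<Rightarrow> 'h) \<Rightarrow> bool" where
  "star_rep M \<pi> \<longleftrightarrow>
     (\<forall>f\<in>L_infinity M. bounded_clinear (\<pi> f)) \<and>
     (\<forall>f\<in>L_infinity M. \<forall>g\<in>L_infinity M. (AE x in M. f x = g x) \<longrightarrow> \<pi> f = \<pi> g) \<and>
     (\<forall>f\<in>L_infinity M. \<forall>g\<in>L_infinity M. \<pi> (\<lambda>x. f x + g x) = (\<lambda>v. \<pi> f v + \<pi> g v)) \<and>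
     (\<forall>c. \<forall>f\<in>L_infinity M. \<pi> (\<lambda>x. c * f x) = (\<lambda>v. c *\<^sub>C \<pi> f v)) \<and>
     (\<forall>f\<in>L_infinity M. \<forall>g\<in>L_infinity M. \<pi> (\<lambda>x. f x * g x) = \<pi> f \<circ> \<pi> g) \<and>
     (\<forall>f\<in>L_infinity M. \<forall>v w. cinner (\<pi> (\<lambda>x. cnj (f x)) v) w = cinner v (\<pi> f w))"

definition wavelet_representation ::
  "('a \<Rightarrow> 'a) \<Rightarrow> 'a measure \<Rightarrow> ('a \<Rightarrow> complex) \<Rightarrow>
   ('h::chilbert_space \<Rightarrow> 'h) \<Rightarrow> (('a \<Rightarrow> complex) \<Rightarrow> 'h \<Rightarrow> 'h) \<Rightarrow> 'h \<Rightarrow> bool" where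
  "wavelet_representation r M m U \<pi> \<phi> \<longleftrightarrow>
     unitary_op U \<and> star_rep M \<pi> \<and>
     (\<forall>f\<in>L_infinity M. U \<circ> \<pi> f \<circ> inv U = \<pi> (f \<circ> r)) \<and>
     U \<phi> = \<pi> m \<phi> \<and>
     (\<forall>f\<in>L_infinity M. cinner (\<pi> f \<phi>) \<phi> = (\<integral>x. f x \<partial>M)) \<and>
     closure {(inv U ^^ n) (\<pi> f \<phi>) | n f. f \<in> L_infinity M} = UNIV"

definition irreducible_rep ::
  "'a measure \<Rightarrow> ('h::chilbert_space \<Rightarrow> 'h) \<Rightarrow> (('a \<Rightarrow> complex) \<Rightarrow> 'h \<Rightarrow> 'h) \<Rightarrow> bool" where
  "irreducible_rep M U \<pi> \<longleftrightarrow>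
     (\<forall>K. closed_csubspace K \<and> U ` K \<subseteq> K \<and> inv U ` K \<subseteq> K \<and>
          (\<forall>f\<in>L_infinity M. \<pi> f ` K \<subseteq> K)
        \<longrightarrow> K = {0} \<or> K = UNIV)"

abbreviation reducible_rep ::
  "'a measure \<Rightarrow> ('h::chilbert_space \<Rightarrow> 'h) \<Rightarrow> (('a \<Rightarrow> complex) \<Rightarrow> 'h \<Rightarrow> 'h) \<Rightarrow> bool" where
  "reducible_rep M U \<pi> \<equiv> \<not> irreducible_rep M U \<pi>"

end

theory Submission imports Defs begin

text \<open>
  Write \<open>m\<^sup>(\<^sup>k\<^sup>) = m \<cdot> m \<circ> r \<cdots> m \<circ> r\<^sup>k\<^sup>-\<^sup>1\<close>.  By Jensen's inequality \<open>\<integral> ln |m|\<^sup>2 d\<mu> < 0\<close>, so the maximal ergodic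
  theorem gives a set \<open>E\<close> of positive measure on which \<open>|m\<^sup>(\<^sup>k\<^sup>)|\<^sup>2\<close> decays exponentially.  Since
  \<open>U\<^sup>k \<phi> = \<pi>(m\<^sup>(\<^sup>k\<^sup>)) \<phi>\<close>, the norms of \<open>\<pi>(1\<^sub>E) U\<^sup>k \<phi>\<close> are summable, and therefore the space of vectors \<open>v\<close>
  with \<open>\<pi>(1\<^sub>E) U\<^sup>n v = 0\<close> for all \<open>n \<ge> 1\<close> is not zero.  If the representation is irreducible, this space
  contains some \<open>w \<noteq> 0\<close> with \<open>\<pi>(1\<^sub>E) w = w\<close>; such vectors form a wandering subspace for \<open>U\<close>, and its
  pieces \<open>\<pi>(1\<^sub>A)\<close> and \<open>\<pi>(1\<^sub>-\<^sub>A)\<close> generate orthogonal invariant subspaces.  Irreducibility forces one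
  of them to vanish on \<open>w\<close> for each Borel set \<open>A\<close>, so \<open>w\<close> is concentrated at a point, which must be an
  atom of \<open>\<mu>\<close>.  An ergodic strongly invariant measure with an atom lives on a single periodic orbit
  whose points have one preimage each, and there the QMF condition reads \<open>|m| = 1\<close>.
\<close>

subsection \<open>Hilbert spaces\<close>

instance chilbert_space \<subseteq> banach ..

lemma cinner_add_right: "cinner x (y + z) = cinner x y + cinner x z"
  by (metis cinner_add_left cinner_commute complex_cnj_add)

lemma cinner_scaleC_right: "cinner x (a *\<^sub>C y) = cnj a * cinner x y"
  by (metis cinner_commute cinner_scaleC_left complex_cnj_mult)

lemma cinner_zero_left [simp]: "cinner 0 x = 0"
  using cinner_add_left [of 0 0 x] by simp

lemma cinner_zero_right [simp]: "cinner x 0 = 0"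
  using cinner_add_right [of x 0 0] by simp

lemma cinner_self: "cinner v v = complex_of_real ((norm v)\<^sup>2)"
proof -
  have "Im (cinner v v) = 0"
    using arg_cong [OF cinner_commute [of v v], of Im] by simp
  then show ?thesis
    by (simp add: complex_eq_iff Re_cinner power2_norm_eq_inner)
qed

text \<open>Together with \<open>Re_cinner\<close> this splits complex orthogonality into two real
  conditions, so that closedness follows from continuity of the real inner product.\<close>

lemma Im_cinner: "Im (cinner x y) = inner x (\<i> *\<^sub>C y)"
  unfolding Re_cinner [symmetric] by (simp add: cinner_scaleC_right)

lemma closed_orthogonal: "closed {u::'h::chilbert_space. cinner u w = 0}"
proof -
  have "{u. cinner u w = 0} = {u. inner u w = 0} \<inter> {u. inner u (\<i> *\<^sub>C w) = 0}"
    by (auto simp: complex_eq_iff Re_cinner Im_cinner)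
  moreover have "closed {u. inner u w = 0}" for w :: 'h
    by (intro closed_Collect_eq continuous_intros)
  ultimately show ?thesis by (metis closed_Int)
qed

text \<open>Remove the \<open>D k\<close> one after another:
  \<open>x (Suc k) = x k - D k (x k)\<close>. By commutation a component once removed stays removed,
  and contractivity bounds each correction by \<open>norm (D k v)\<close>. The corrections add up to
  less than \<open>norm v\<close>, so the limit is not zero.\<close>

lemma limit_of_commuting_projections:
  fixes D :: "nat \<Rightarrow> 'h::banach \<Rightarrow> 'h"
  assumes lin: "\<And>j. bounded_linear (D j)"
    and comm: "\<And>j k v. D j (D k v) = D k (D j v)"
    and idem: "\<And>j v. D j (D j v) = D j v"
    and contr: "\<And>j v. norm (v - D j v) \<le> norm v"
    and summ: "summable (\<lambda>j. norm (D j v))"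
    and small: "(\<Sum>j. norm (D j v)) < norm v"
  shows "\<exists>u. u \<noteq> 0 \<and> (\<forall>j. D j u = 0)"
proof -
  define x where "x = rec_nat v (\<lambda>k y. y - D k y)"
  have x0: "x 0 = v" and xS: "x (Suc k) = x k - D k (x k)" for k
    by (simp_all add: x_def)
  have diff: "D j (y - z) = D j y - D j z" for j y z
    using lin bounded_linear.linear linear_diff by blast
  have mono: "norm (D j (x k)) \<le> norm (D j v)" for j k
  proof (induction k)
    case (Suc k)
    have "D j (x (Suc k)) = D j (x k) - D k (D j (x k))"
      by (simp add: xS diff comm)
    then show ?case using contr [of "D j (x k)" k] Suc by simp
  qed (simp add: x0)
  have zero: "D j (x k) = 0" if "j < k" for j k
    using that
  proof (induction k)
    case (Suc k)
    have e: "D j (x (Suc k)) = D j (x k) - D k (D j (x k))"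
      by (simp add: xS diff comm)
    show ?case
    proof (cases "j = k")
      case True
      then show ?thesis using e by (simp add: idem)
    next
      case False
      then have "D j (x k) = 0" using Suc by simp
      then show ?thesis using e diff [of k 0 0] by simp
    qed
  qed simp
  have ns: "summable (\<lambda>k. norm (D k (x k)))"
    by (rule summable_comparison_test' [OF summ, of 0]) (simp add: mono)
  define s where "s = (\<Sum>k. D k (x k))"
  have sums: "(\<lambda>k. D k (x k)) sums s"
    unfolding s_def by (rule summable_sums [OF summable_norm_cancel [OF ns]])
  have xn: "x n = v - (\<Sum>k<n. D k (x k))" for n
    by (induction n) (simp_all add: x0 xS)
  have lim: "x \<longlonglongrightarrow> v - s"
  proof -
    have "(\<lambda>n. v - (\<Sum>k<n. D k (x k))) \<longlonglongrightarrow> v - s"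
      using sums unfolding sums_def by (intro tendsto_intros)
    then show ?thesis by (simp only: xn[symmetric])
  qed
  have "norm s \<le> (\<Sum>k. norm (D k (x k)))"
    unfolding s_def by (rule summable_norm [OF ns])
  also have "\<dots> \<le> (\<Sum>k. norm (D k v))"
    by (rule suminf_le [OF _ ns summ]) (simp add: mono)
  also have "\<dots> < norm v" by (fact small)
  finally have "v - s \<noteq> 0" by auto
  moreover have "D j (v - s) = 0" for j
  proof -
    have "(\<lambda>n. D j (x n)) \<longlonglongrightarrow> D j (v - s)"
      by (rule bounded_linear.tendsto [OF lin lim])
    moreover have "(\<lambda>n. D j (x n)) \<longlonglongrightarrow> 0"
      by (rule tendsto_eventually, rule eventually_sequentiallyI [of "Suc j"]) (simp add: zero)
    ultimately show ?thesis by (rule LIMSEQ_unique)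
  qed
  ultimately show ?thesis by blast
qed

subsection \<open>The maximal ergodic theorem\<close>

lemma measure_preserving_iterate:
  assumes "r \<in> measurable M M" and "distr M M r = M"
  shows "(r ^^ n) \<in> measurable M M" and "distr M M (r ^^ n) = M"
proof -
  have "(r ^^ n) \<in> measurable M M \<and> distr M M (r ^^ n) = M"
  proof (induction n)
    case 0
    then show ?case by (simp add: id_def)
  next
    case (Suc n)
    have "distr M M (r \<circ> (r ^^ n)) = distr (distr M M (r ^^ n)) M r"
      using Suc assms by (intro distr_distr[symmetric]) auto
    then show ?case using Suc assms by (simp add: measurable_comp comp_def)
  qed
  then show "(r ^^ n) \<in> measurable M M" "distr M M (r ^^ n) = M" by auto
qed

text \<open>Garsia's proof of the maximal ergodic theorem: \<open>G n\<close> is the maximum of the first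
  \<open>n + 1\<close> ergodic sums, the empty one included.\<close>

lemma nonpositive_ergodic_sums:
  fixes f :: "'a \<Rightarrow> real"
  assumes T: "T \<in> measurable M M" and inv: "distr M M T = M"
    and f: "integrable M f" and neg: "integral\<^sup>L M f < 0"
  shows "\<exists>E\<in>sets M. emeasure M E \<noteq> 0 \<and> (\<forall>x\<in>E. \<forall>n. (\<Sum>k<n. f ((T ^^ k) x)) \<le> 0)"
proof -
  define G where "G = rec_nat (\<lambda>x. 0) (\<lambda>n g x. max 0 (f x + g (T x)))"
  have G0: "G 0 x = 0" and GS: "G (Suc n) x = max 0 (f x + G n (T x))" for n x
    by (simp_all add: G_def)
  have G_comp: "integrable M (\<lambda>x. g (T x))" "(\<integral>x. g (T x) \<partial>M) = integral\<^sup>L M g"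
    if "integrable M g" for g :: "'a \<Rightarrow> real"
    using integrable_distr_eq [OF T, of g] integral_distr [OF T, of g] that inv by auto
  have int: "integrable M (G n)" for n
  proof (induction n)
    case 0
    then show ?case by (simp add: G_def)
  next
    case (Suc n)
    have "G (Suc n) = (\<lambda>x. max 0 (f x + G n (T x)))" by (simp add: GS fun_eq_iff)
    then show ?case using G_comp(1)[OF Suc] f by simp
  qed
  have nonneg: "0 \<le> G n x" for n x by (cases n) (simp_all add: G0 GS)
  have step: "G n x \<le> G (Suc n) x" for n x
  proof (induction n arbitrary: x)
    case (Suc n)
    show ?case unfolding GS[of "Suc n" x] GS[of n x] using Suc[of "T x"] by simp
  qed (simp add: G0 nonneg)
  have sum_le: "(\<Sum>k<n. f ((T ^^ k) x)) \<le> G n x" for n x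
  proof (induction n arbitrary: x)
    case (Suc n)
    have "(\<Sum>k<Suc n. f ((T ^^ k) x)) = f x + (\<Sum>k<n. f ((T ^^ k) (T x)))"
      by (simp add: sum.lessThan_Suc_shift funpow_swap1 del: sum.lessThan_Suc)
    then show ?case using Suc[of "T x"] by (simp add: GS)
  qed (simp add: G0)
  define A where "A n = {x \<in> space M. 0 < G n x}" for n
  have mG [measurable]: "G n \<in> borel_measurable M" for n using int by auto
  have mf [measurable]: "f \<in> borel_measurable M" using f by auto
  have A [measurable]: "A n \<in> sets M" for n unfolding A_def by measurable
  have incA: "incseq A"
    by (rule incseq_SucI) (auto simp: A_def intro: less_le_trans[OF _ step])
  have pos: "0 \<le> (\<integral>x. indicator (A n) x * f x \<partial>M)" for n
  proof (cases n)
    case 0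
    then show ?thesis by (simp add: A_def G0)
  next
    case (Suc k)
    \<comment> \<open>On \<open>A n\<close> with \<open>n = Suc k\<close>,
      \<open>G n = f + G k \<circ> T \<le> f + G n \<circ> T\<close>; off \<open>A n\<close>,
      \<open>G n\<close> is 0 and \<open>G n \<circ> T\<close> is nonnegative. Invariance makes the
      integral of the difference vanish.\<close>
    have "0 = (\<integral>x. G n x - G n (T x) \<partial>M)"
      using G_comp[OF int[of n]] int[of n] by simp
    also have "\<dots> \<le> (\<integral>x. indicator (A n) x * f x \<partial>M)"
    proof (rule integral_mono)
      show "integrable M (\<lambda>x. G n x - G n (T x))" using G_comp[OF int[of n]] int[of n] by simp
      show "integrable M (\<lambda>x. indicator (A n) x * f x)"
        using integrable_mult_indicator[OF A f] by simp
      fix x assume x: "x \<in> space M"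
      show "G n x - G n (T x) \<le> indicator (A n) x * f x"
        using step[of k "T x"] nonneg[of n "T x"] x
        by (auto simp: A_def indicator_def Suc GS[of k x] max_def split: if_splits)
    qed
    finally show ?thesis .
  qed
  have "(\<lambda>n. \<integral>x. indicator (A n) x * f x \<partial>M) \<longlonglongrightarrow> (\<integral>x. indicator (\<Union>n. A n) x * f x \<partial>M)"
  proof (rule integral_dominated_convergence[where w = "\<lambda>x. \<bar>f x\<bar>"])
    show "AE x in M. (\<lambda>n. indicator (A n) x * f x) \<longlonglongrightarrow> indicator (\<Union>n. A n) x * f x"
      by (intro AE_I2 tendsto_mult tendsto_const LIMSEQ_indicator_incseq[OF incA])
  qed (use f in \<open>auto simp: indicator_def\<close>)
  then have UA: "0 \<le> (\<integral>x. indicator (\<Union>n. A n) x * f x \<partial>M)"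
    by (rule LIMSEQ_le_const) (use pos in auto)
  define E where "E = space M - (\<Union>n. A n)"
  have Es: "E \<in> sets M" by (auto simp: E_def)
  \<comment> \<open>Were \<open>E\<close> null, the integral of \<open>f\<close> would equal its
    integral over the union of the \<open>A n\<close>, which is nonnegative.\<close>
  have "emeasure M E \<noteq> 0"
  proof
    assume "emeasure M E = 0"
    then have "AE x in M. x \<notin> E" using Es by (intro AE_not_in) (auto simp: null_sets_def)
    then have "AE x in M. f x = indicator (\<Union>n. A n) x * f x"
      by (rule AE_mp) (rule AE_I2, auto simp: E_def)
    then have "integral\<^sup>L M f = (\<integral>x. indicator (\<Union>n. A n) x * f x \<partial>M)"
      by (intro integral_cong_AE) auto
    then show False using UA neg by simp
  qed
  moreover have "(\<Sum>k<n. f ((T ^^ k) x)) \<le> 0" if "x \<in> E" for x n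
  proof -
    have "G n x \<le> 0" using that by (auto simp: E_def A_def not_less)
    then show ?thesis using sum_le[where n = n and x = x] by simp
  qed
  ultimately show ?thesis using Es by blast
qed

subsection \<open>Covariant representations of \<open>L\<^sup>\<infinity>\<close>\<close>

lemma indicator_square: "indicator A x * indicator A x = (indicator A x :: complex)"
  by (simp add: indicator_def)

lemma L_infinity_const [simp]: "(\<lambda>x. c) \<in> L_infinity M"
  by (auto simp: L_infinity_def intro!: exI[of _ "cmod c"])

lemma L_infinity_indicator [simp]:
  assumes "A \<in> sets M"
  shows "(indicator A :: _ \<Rightarrow> complex) \<in> L_infinity M"
  using assms by (auto simp: L_infinity_def indicator_def intro!: exI[of _ 1] borel_measurable_indicator)

lemma L_infinity_mult:
  assumes "f \<in> L_infinity M" and "g \<in> L_infinity M"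
  shows "(\<lambda>x. f x * g x) \<in> L_infinity M"
proof -
  obtain C D where C: "AE x in M. norm (f x) \<le> C" and D: "AE x in M. norm (g x) \<le> D"
    using assms by (auto simp: L_infinity_def)
  have "AE x in M. norm (f x * g x) \<le> \<bar>C\<bar> * \<bar>D\<bar>"
    using C D by eventually_elim (auto simp: norm_mult intro!: mult_mono)
  then show ?thesis using assms by (auto simp: L_infinity_def)
qed

lemma L_infinity_prod:
  fixes f :: "nat \<Rightarrow> 'a \<Rightarrow> complex"
  assumes "\<And>k. k < n \<Longrightarrow> f k \<in> L_infinity M"
  shows "(\<lambda>x. \<Prod>k<n. f k x) \<in> L_infinity M"
  using assms by (induction n) (simp_all add: L_infinity_mult)

lemma L_infinity_cnj:
  assumes "f \<in> L_infinity M"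
  shows "(\<lambda>x. cnj (f x)) \<in> L_infinity M"
proof -
  have "cnj \<in> borel_measurable borel"
    by (intro borel_measurable_continuous_onI continuous_intros)
  then have "(\<lambda>x. cnj (f x)) \<in> borel_measurable M"
    using assms measurable_compose[of f M borel cnj borel] by (simp add: L_infinity_def)
  then show ?thesis using assms by (simp add: L_infinity_def)
qed

text \<open>Invariance makes preimages of null sets null, which carries the essential bound
  over.\<close>

lemma L_infinity_comp:
  assumes "T \<in> measurable M M" and "distr M M T = M" and "f \<in> L_infinity M"
  shows "f \<circ> T \<in> L_infinity M"
proof -
  obtain C where "AE x in M. norm (f x) \<le> C" and f: "f \<in> borel_measurable M"
    using assms by (auto simp: L_infinity_def)
  then have "AE x in distr M M T. norm (f x) \<le> C"
    unfolding assms(2) by simp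
  then have "AE x in M. norm (f (T x)) \<le> C"
    by (rule AE_distrD[OF assms(1)])
  moreover have "f \<circ> T \<in> borel_measurable M"
    by (rule measurable_comp[OF assms(1) f])
  ultimately show ?thesis by (auto simp: L_infinity_def)
qed

lemma (in finite_measure) L_infinity_integrable:
  assumes "f \<in> L_infinity M"
  shows "integrable M f"
  using assms by (auto simp: L_infinity_def intro: integrable_const_bound)

lemma bounded_linear_funpow:
  fixes T :: "'b::real_normed_vector \<Rightarrow> 'b"
  assumes "bounded_linear T"
  shows "bounded_linear (T ^^ n)"
proof (induction n)
  case 0
  then show ?case by (simp add: id_def bounded_linear_ident)
next
  case (Suc n)
  then show ?case
    using bounded_linear_compose[OF assms Suc] by (simp add: comp_def)
qed

section \<open>The unitary operator, covariance and the spectral projections\<close>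

locale wavelet_rep = finite_measure \<mu> for \<mu> :: "'a measure" +
  fixes r :: "'a \<Rightarrow> 'a" and m :: "'a \<Rightarrow> complex"
    and U :: "'h::chilbert_space \<Rightarrow> 'h" and \<pi> :: "('a \<Rightarrow> complex) \<Rightarrow> 'h \<Rightarrow> 'h" and \<phi> :: 'h
  assumes space: "space \<mu> = UNIV"
    and r_meas: "r \<in> measurable \<mu> \<mu>" and r_distr: "distr \<mu> \<mu> r = \<mu>"
    and m_Linf: "m \<in> L_infinity \<mu>"
    and rep: "wavelet_representation r \<mu> m U \<pi> \<phi>"
begin

abbreviation "Linf \<equiv> L_infinity \<mu>"

lemma unitary: "unitary_op U" and star: "star_rep \<mu> \<pi>"
  and cov0: "f \<in> Linf \<Longrightarrow> U \<circ> \<pi> f \<circ> inv U = \<pi> (f \<circ> r)"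
  and scaling: "U \<phi> = \<pi> m \<phi>"
  and orth: "f \<in> Linf \<Longrightarrow> cinner (\<pi> f \<phi>) \<phi> = (\<integral>x. f x \<partial>\<mu>)"
  and dense: "closure {(inv U ^^ n) (\<pi> f \<phi>) | n f. f \<in> Linf} = UNIV"
  using rep unfolding wavelet_representation_def by blast+

lemma U_linear: "bounded_linear U" and U_scale: "U (c *\<^sub>C v) = c *\<^sub>C U v"
  and U_surj: "surj U" and U_cinner: "cinner (U v) (U w) = cinner v w"
  using unitary unfolding unitary_op_def bounded_clinear_def by blast+

lemma U_norm: "norm (U v) = norm v"
  using U_cinner[of v v] unfolding cinner_self of_real_eq_iff by simp

lemma U_inj: "inj U"
proof (rule injI)
  fix v w assume "U v = U w"
  then have "U (v - w) = 0"
    by (simp add: linear_diff[OF bounded_linear.linear[OF U_linear]])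
  then show "v = w" using U_norm[of "v - w"] by simp
qed

lemma U_inv [simp]: "U (inv U v) = v" and inv_U [simp]: "inv U (U v) = v"
  by (simp_all add: U_surj surj_f_inv_f U_inj)

lemma inv_U_linear: "bounded_linear (inv U)"
proof (rule bounded_linear_intro[where K = 1])
  show "inv U (x + y) = inv U x + inv U y" for x y
    using linear_add[OF bounded_linear.linear[OF U_linear], of "inv U x" "inv U y"]
    by (metis U_inv inv_U)
  show "inv U (c *\<^sub>R x) = c *\<^sub>R inv U x" for c x
    using linear_scale[OF bounded_linear.linear[OF U_linear], of c "inv U x"]
    by (metis U_inv inv_U)
  show "norm (inv U x) \<le> norm x * 1" for x
    using U_norm[of "inv U x"] by simp
qed

lemma Un_inv [simp]: "(U ^^ n) ((inv U ^^ n) v) = v"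
proof (induction n)
  case (Suc n)
  have "(U ^^ Suc n) ((inv U ^^ Suc n) v) = (U ^^ n) (U (inv U ((inv U ^^ n) v)))"
    by (simp only: funpow_Suc_right[of n "U"] funpow.simps(2)[of n "inv U"] comp_apply)
  then show ?case using Suc by simp
qed simp

lemma inv_Un [simp]: "(inv U ^^ n) ((U ^^ n) v) = v"
proof (induction n)
  case (Suc n)
  have "(inv U ^^ Suc n) ((U ^^ Suc n) v) = (inv U ^^ n) (inv U (U ((U ^^ n) v)))"
    by (simp only: funpow_Suc_right[of n "inv U"] funpow.simps(2)[of n "U"] comp_apply)
  then show ?case using Suc by simp
qed simp

lemmas Un_linear = bounded_linear_funpow[OF U_linear]
lemmas inv_Un_linear = bounded_linear_funpow[OF inv_U_linear]

lemma Un_cinner: "cinner ((U ^^ n) v) ((U ^^ n) w) = cinner v w"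
  by (induction n) (simp_all add: U_cinner)

lemma Un_norm: "norm ((U ^^ n) v) = norm v"
  by (induction n) (simp_all add: U_norm)

lemma inv_Un_norm: "norm ((inv U ^^ n) v) = norm v"
  by (metis Un_inv Un_norm)

lemma Un_scale: "(U ^^ n) (c *\<^sub>C v) = c *\<^sub>C (U ^^ n) v"
  by (induction n) (simp_all add: U_scale)

lemma pi_linear: "f \<in> Linf \<Longrightarrow> bounded_linear (\<pi> f)"
  and pi_scale: "f \<in> Linf \<Longrightarrow> \<pi> f (c *\<^sub>C v) = c *\<^sub>C \<pi> f v"
  and pi_adj: "f \<in> Linf \<Longrightarrow> cinner (\<pi> (\<lambda>x. cnj (f x)) v) w = cinner v (\<pi> f w)"
  using star unfolding star_rep_def bounded_clinear_def by blast+

lemma pi_plus: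
  assumes "f \<in> Linf" and "g \<in> Linf"
  shows "\<pi> (\<lambda>x. f x + g x) v = \<pi> f v + \<pi> g v"
proof -
  have "\<pi> (\<lambda>x. f x + g x) = (\<lambda>v. \<pi> f v + \<pi> g v)"
    using star assms unfolding star_rep_def by blast
  then show ?thesis by (rule fun_cong)
qed

lemma pi_mult:
  assumes "f \<in> Linf" and "g \<in> Linf"
  shows "\<pi> (\<lambda>x. f x * g x) v = \<pi> f (\<pi> g v)"
proof -
  have "\<pi> (\<lambda>x. f x * g x) = \<pi> f \<circ> \<pi> g"
    using star assms unfolding star_rep_def by blast
  from fun_cong[OF this, of v] show ?thesis by (simp only: comp_apply)
qed

lemma pi_commute: "f \<in> Linf \<Longrightarrow> g \<in> Linf \<Longrightarrow> \<pi> f (\<pi> g v) = \<pi> g (\<pi> f v)"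
  by (subst (1 2) pi_mult[symmetric]) (simp_all add: mult.commute)

lemma pi_adj': "f \<in> Linf \<Longrightarrow> cinner (\<pi> f v) w = cinner v (\<pi> (\<lambda>x. cnj (f x)) w)"
  using pi_adj[OF L_infinity_cnj, of f v w] by simp

lemma rn_meas: "(r ^^ n) \<in> measurable \<mu> \<mu>" and rn_distr: "distr \<mu> \<mu> (r ^^ n) = \<mu>"
  by (fact measure_preserving_iterate[OF r_meas r_distr])+

lemma comp_rn: "f \<in> Linf \<Longrightarrow> f \<circ> (r ^^ n) \<in> Linf"
  by (rule L_infinity_comp[OF rn_meas rn_distr])

lemma covariance: "f \<in> Linf \<Longrightarrow> U (\<pi> f v) = \<pi> (f \<circ> r) (U v)"
  using fun_cong[OF cov0, of f "U v"] by simp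

lemma covariance_Un: "f \<in> Linf \<Longrightarrow> (U ^^ n) (\<pi> f v) = \<pi> (f \<circ> (r ^^ n)) ((U ^^ n) v)"
proof (induction n)
  case (Suc n)
  have "(U ^^ Suc n) (\<pi> f v) = U (\<pi> (f \<circ> (r ^^ n)) ((U ^^ n) v))"
    by (subst funpow.simps(2), subst comp_apply, subst Suc.IH[OF Suc.prems], rule refl)
  also have "\<dots> = \<pi> (f \<circ> (r ^^ n) \<circ> r) ((U ^^ Suc n) v)"
    by (simp add: covariance comp_rn Suc.prems)
  also have "f \<circ> (r ^^ n) \<circ> r = f \<circ> (r ^^ Suc n)"
    by (simp only: comp_assoc funpow_Suc_right)
  finally show ?case .
qed simp

text \<open>In this direction the function is only composed with \<open>r ^^ n\<close>, so
  multiplication operators preserve the form \<open>(inv U ^^ n) (\<pi> g \<phi>)\<close> of the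
  vectors in the density condition.\<close>

lemma covariance_inv_Un:
  assumes "f \<in> Linf"
  shows "\<pi> f ((inv U ^^ n) v) = (inv U ^^ n) (\<pi> (f \<circ> (r ^^ n)) v)"
proof -
  have "(U ^^ n) (\<pi> f ((inv U ^^ n) v)) = \<pi> (f \<circ> (r ^^ n)) v"
    using covariance_Un[OF assms, of n "(inv U ^^ n) v"] by (simp only: Un_inv)
  from arg_cong[OF this, of "inv U ^^ n"] show ?thesis by (simp only: inv_Un)
qed

text \<open>The fixed vectors form a closed set, and it contains the dense set because the constant
  1 is unchanged by composition with \<open>r ^^ n\<close>.\<close>

lemma unital: "\<pi> (\<lambda>x. 1) v = v"
proof -
  have "closed {v. \<pi> (\<lambda>x. 1) v = v}"
    by (intro closed_Collect_eq linear_continuous_on[OF pi_linear] continuous_on_id) simp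
  moreover have "{(inv U ^^ n) (\<pi> f \<phi>) | n f. f \<in> Linf} \<subseteq> {v. \<pi> (\<lambda>x. 1) v = v}"
    using pi_mult[of "\<lambda>x. 1"] by (auto simp: covariance_inv_Un comp_def)
  ultimately show ?thesis
    using dense closure_minimal by blast
qed

text \<open>The spectral measure of \<open>\<pi>\<close>: indicators are real and idempotent, so
  these are orthogonal projections.\<close>

definition proj :: "'a set \<Rightarrow> 'h \<Rightarrow> 'h" where
  "proj A = \<pi> (indicator A)"

lemma proj_linear: "A \<in> sets \<mu> \<Longrightarrow> bounded_linear (proj A)"
  by (simp add: proj_def pi_linear)

lemma proj_zero [simp]: "A \<in> sets \<mu> \<Longrightarrow> proj A 0 = 0"
  using proj_linear linear_0 bounded_linear.linear by blast

lemma proj_Int: "A \<in> sets \<mu> \<Longrightarrow> B \<in> sets \<mu> \<Longrightarrow> proj A (proj B v) = proj (A \<inter> B) v"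
  by (simp add: proj_def pi_mult[symmetric] indicator_inter_arith[abs_def])

lemma proj_adj: "A \<in> sets \<mu> \<Longrightarrow> cinner (proj A v) w = cinner v (proj A w)"
proof -
  have "(\<lambda>x. cnj (indicator A x)) = indicator A"
    by (auto simp: indicator_def fun_eq_iff)
  moreover assume "A \<in> sets \<mu>"
  ultimately show ?thesis
    using pi_adj'[of "indicator A" v w] by (simp add: proj_def)
qed

lemma proj_commute: "A \<in> sets \<mu> \<Longrightarrow> f \<in> Linf \<Longrightarrow> proj A (\<pi> f v) = \<pi> f (proj A v)"
  by (simp add: proj_def pi_commute)

lemma proj_Compl: "A \<in> sets \<mu> \<Longrightarrow> proj (- A) v = v - proj A v"
proof -
  assume A: "A \<in> sets \<mu>"
  then have "- A \<in> sets \<mu>"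
    using sets.compl_sets[OF A] by (simp add: space Compl_eq_Diff_UNIV)
  then have "proj (- A) v + proj A v = \<pi> (\<lambda>x. indicator (- A) x + indicator A x) v"
    using A by (simp add: proj_def pi_plus)
  also have "(\<lambda>x. indicator (- A) x + indicator A x :: complex) = (\<lambda>x. 1)"
    by (auto simp: indicator_def)
  finally show ?thesis by (simp add: unital algebra_simps)
qed

lemma proj_norm2: "A \<in> sets \<mu> \<Longrightarrow> complex_of_real ((norm (proj A v))\<^sup>2) = cinner (proj A v) v"
  unfolding cinner_self[symmetric] using proj_adj[of A "proj A v" v] by (simp add: proj_Int)

lemma proj_norm: "A \<in> sets \<mu> \<Longrightarrow> norm (proj A v) \<le> norm v"
proof -
  assume A: "A \<in> sets \<mu>"
  have "(norm (proj A v))\<^sup>2 = inner (proj A v) v"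
    using arg_cong[OF proj_norm2[OF A, of v], of Re] by (simp add: Re_cinner)
  also have "\<dots> \<le> norm (proj A v) * norm v" by (rule norm_cauchy_schwarz)
  finally show ?thesis
    by (cases "proj A v = 0") (auto simp: power2_eq_square)
qed

text \<open>The orthogonality condition for \<open>cnj f * f\<close>. It turns norms of vectors in
  the orbit of \<open>\<phi>\<close> into integrals.\<close>

lemma pi_phi_norm:
  assumes "f \<in> Linf"
  shows "(norm (\<pi> f \<phi>))\<^sup>2 = (\<integral>x. (cmod (f x))\<^sup>2 \<partial>\<mu>)"
proof -
  have "complex_of_real ((norm (\<pi> f \<phi>))\<^sup>2) = cinner (\<pi> (\<lambda>x. cnj (f x) * f x) \<phi>) \<phi>"
    unfolding cinner_self[symmetric] by (simp add: pi_mult L_infinity_cnj assms pi_adj)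
  also have "\<dots> = (\<integral>x. complex_of_real ((cmod (f x))\<^sup>2) \<partial>\<mu>)"
    using assms
    by (simp only: orth L_infinity_mult L_infinity_cnj complex_norm_square mult.commute)
  finally show ?thesis unfolding integral_complex_of_real of_real_eq_iff .
qed

text \<open>The scaling equation replaces the innermost \<open>U\<close> by \<open>\<pi> m\<close>,
  and covariance moves it outwards as the factor \<open>m \<circ> (r ^^ n)\<close>.\<close>

lemma Un_phi: "(U ^^ n) \<phi> = \<pi> (\<lambda>x. \<Prod>k<n. m ((r ^^ k) x)) \<phi>"
proof (induction n)
  case 0
  then show ?case by (simp add: unital)
next
  case (Suc n)
  have L: "(\<lambda>x. \<Prod>k<n. m ((r ^^ k) x)) \<in> Linf" for n
    using comp_rn[OF m_Linf] by (intro L_infinity_prod) (simp add: comp_def)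
  have "(U ^^ Suc n) \<phi> = (U ^^ n) (\<pi> m \<phi>)"
    by (simp only: scaling[symmetric] funpow_Suc_right comp_apply)
  also have "\<dots> = \<pi> (m \<circ> (r ^^ n)) (\<pi> (\<lambda>x. \<Prod>k<n. m ((r ^^ k) x)) \<phi>)"
    by (simp add: covariance_Un m_Linf Suc)
  also have "\<dots> = \<pi> (\<lambda>x. \<Prod>k<Suc n. m ((r ^^ k) x)) \<phi>"
    using pi_mult[OF comp_rn[OF m_Linf, of n] L[of n]] by (simp add: mult.commute)
  finally show ?case .
qed

lemma phi_norm: "(norm \<phi>)\<^sup>2 = measure \<mu> UNIV"
  using pi_phi_norm[of "\<lambda>x. 1"] by (simp add: unital space[symmetric])

subsection \<open>Wandering vectors\<close>

text \<open>Formally this is multiplication by \<open>f\<close> composed with the inverse of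
  \<open>r ^^ n\<close>. Over all \<open>n\<close> these operators form an increasing union of
  commutative algebras.\<close>

definition conjugate :: "nat \<Rightarrow> ('a \<Rightarrow> complex) \<Rightarrow> 'h \<Rightarrow> 'h" where
  "conjugate n f v = (inv U ^^ n) (\<pi> f ((U ^^ n) v))"

lemma conjugate_0 [simp]: "conjugate 0 f v = \<pi> f v"
  by (simp add: conjugate_def)

lemma Un_conjugate: "(U ^^ n) (conjugate n f v) = \<pi> f ((U ^^ n) v)"
  by (simp add: conjugate_def)

lemma conjugate_linear: "f \<in> Linf \<Longrightarrow> bounded_linear (conjugate n f)"
  unfolding conjugate_def
  by (intro bounded_linear_compose[OF inv_Un_linear] bounded_linear_compose[OF pi_linear] Un_linear)

lemma conjugate_scale: "f \<in> Linf \<Longrightarrow> conjugate n f (c *\<^sub>C v) = c *\<^sub>C conjugate n f v"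
  by (metis (no_types, lifting) Un_conjugate Un_scale inv_Un pi_scale)

lemma conjugate_mult: "f \<in> Linf \<Longrightarrow> g \<in> Linf \<Longrightarrow> conjugate n f (conjugate n g v) = conjugate n (\<lambda>x. f x * g x) v"
  by (simp add: conjugate_def pi_mult)

text \<open>Covariance embeds level \<open>n\<close> into level \<open>n + k\<close>, so that
  operators of different levels can be compared at a common one.\<close>

lemma conjugate_shift:
  assumes "f \<in> Linf"
  shows "conjugate n f v = conjugate (n + k) (f \<circ> (r ^^ k)) v"
proof -
  have "(U ^^ (n + k)) v = (U ^^ k) ((U ^^ n) v)"
    by (subst add.commute) (simp only: funpow_add comp_apply)
  then show ?thesis
    unfolding conjugate_def
    by (simp only: covariance_Un[OF assms, symmetric] funpow_add comp_apply inv_Un)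
qed

text \<open>At the common level \<open>n + k\<close> both operators are multiplications conjugated
  by the same power of \<open>U\<close>.\<close>

lemma conjugate_commute:
  assumes "f \<in> Linf" and "g \<in> Linf"
  shows "conjugate n f (conjugate k g v) = conjugate k g (conjugate n f v)"
proof -
  have f: "conjugate n f u = conjugate (n + k) (f \<circ> (r ^^ k)) u"
    and g: "conjugate k g u = conjugate (n + k) (g \<circ> (r ^^ n)) u" for u
    using conjugate_shift[OF assms(1), of n u k] conjugate_shift[OF assms(2), of k u n]
    by (simp_all only: add.commute[of k n])
  show ?thesis
    unfolding f g by (simp add: conjugate_mult comp_rn assms mult.commute del: comp_apply)
qed

lemma conjugate_zero [simp]: "f \<in> Linf \<Longrightarrow> conjugate n f 0 = 0"
  using conjugate_linear linear_0 bounded_linear.linear by blast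

text \<open>The orthogonal complement of \<open>S\<close> is a closed invariant subspace, because
  adjoints of the operators involved are again among them. It contains \<open>u\<close>, so by
  irreducibility it is everything, and \<open>x\<close> is orthogonal to itself.\<close>

lemma invariant_subset_zero:
  assumes irr: "irreducible_rep \<mu> U \<pi>"
    and S: "\<And>x. x \<in> S \<Longrightarrow> U x \<in> S" "\<And>x. x \<in> S \<Longrightarrow> inv U x \<in> S"
      "\<And>f x. f \<in> Linf \<Longrightarrow> x \<in> S \<Longrightarrow> \<pi> f x \<in> S"
    and u: "u \<noteq> 0" "\<And>x. x \<in> S \<Longrightarrow> cinner u x = 0" and x: "x \<in> S"
  shows "x = 0"
proof -
  define K where "K = {u. \<forall>x\<in>S. cinner u x = 0}"
  have "K = (\<Inter>x\<in>S. {u. cinner u x = 0})" by (auto simp: K_def)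
  then have "closed K" by (simp add: closed_INT closed_orthogonal)
  then have "closed_csubspace K"
    unfolding closed_csubspace_def by (auto simp: K_def cinner_add_left cinner_scaleC_left)
  moreover have "U ` K \<subseteq> K"
  proof clarify
    fix v assume "v \<in> K"
    then have "cinner v (inv U x) = 0" if "x \<in> S" for x using S(2) that by (auto simp: K_def)
    then show "U v \<in> K" using U_cinner[of v "inv U _"] by (auto simp: K_def)
  qed
  moreover have "inv U ` K \<subseteq> K"
  proof clarify
    fix v assume "v \<in> K"
    then have "cinner v (U x) = 0" if "x \<in> S" for x using S(1) that by (auto simp: K_def)
    then show "inv U v \<in> K" using U_cinner[of "inv U v"] by (auto simp: K_def)
  qed
  moreover have "\<forall>f\<in>Linf. \<pi> f ` K \<subseteq> K"
    using S(3) by (auto simp: K_def pi_adj' L_infinity_cnj)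
  ultimately have "K = {0} \<or> K = UNIV" using irr unfolding irreducible_rep_def by blast
  moreover have "u \<in> K" using u by (simp add: K_def)
  ultimately have "x \<in> K" using u(1) by auto
  then have "cinner x x = 0" using x by (auto simp: K_def)
  then show ?thesis by (simp add: cinner_self)
qed

text \<open>Stated with conjugates because for an indicator these are commuting projections. The
  index \<open>Suc n\<close> leaves level 0 free, so an outgoing vector may still have a component
  in \<open>E\<close>.\<close>

definition outgoing :: "'a set \<Rightarrow> 'h set" where
  "outgoing E = {v. \<forall>n. conjugate (Suc n) (indicator E) v = 0}"

lemma outgoing_iff: "E \<in> sets \<mu> \<Longrightarrow> v \<in> outgoing E \<longleftrightarrow> (\<forall>n. proj E ((U ^^ Suc n) v) = 0)"
proof -
  have "conjugate n (indicator E) v = 0 \<longleftrightarrow> proj E ((U ^^ n) v) = 0" for n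
    using inv_Un_norm[of n "proj E ((U ^^ n) v)"] by (metis conjugate_def norm_eq_zero proj_def)
  then show ?thesis by (simp add: outgoing_def)
qed

text \<open>Commuting operators preserve each other's kernels.\<close>

lemma conjugate_outgoing:
  "E \<in> sets \<mu> \<Longrightarrow> f \<in> Linf \<Longrightarrow> v \<in> outgoing E \<Longrightarrow> conjugate n f v \<in> outgoing E"
  by (simp add: outgoing_def conjugate_commute[where f = "indicator E" and g = f])

text \<open>For large \<open>N\<close> the tail of the series from \<open>N\<close> on is smaller
  than \<open>norm \<phi>\<close>. Then the projections that define \<open>outgoing E\<close> can be
  removed from a shift of \<open>\<phi>\<close> without reaching 0.\<close>

lemma outgoing_nonzero:
  assumes E: "E \<in> sets \<mu>" and summ: "summable (\<lambda>k. norm (proj E ((U ^^ k) \<phi>)))" and "\<phi> \<noteq> 0"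
  shows "\<exists>v\<in>outgoing E. v \<noteq> 0"
proof -
  have norm_conjugate: "norm (conjugate k (indicator E) v) = norm (proj E ((U ^^ k) v))" for k v
    by (simp add: conjugate_def inv_Un_norm proj_def)
  obtain N where N: "norm (\<Sum>i. norm (proj E ((U ^^ (i + N)) \<phi>))) < norm \<phi>"
    using suminf_exist_split[OF _ summ, of "norm \<phi>"] \<open>\<phi> \<noteq> 0\<close> by auto
  \<comment> \<open>The extra \<open>inv U\<close> compensates for the index starting at 1:
    \<open>Suc n\<close> steps from \<open>v\<close> lead to
    \<open>(U ^^ (n + N)) \<phi>\<close>.\<close>
  define v where "v = inv U ((U ^^ N) \<phi>)"
  have v: "(U ^^ Suc n) v = (U ^^ (n + N)) \<phi>" for n
    by (simp add: v_def funpow_Suc_right funpow_add del: funpow.simps)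
  have "norm v = norm \<phi>" using U_norm[of v] by (simp add: v_def Un_norm)
  have nD: "norm (conjugate (Suc j) (indicator E) v) = norm (proj E ((U ^^ (j + N)) \<phi>))" for j
    unfolding norm_conjugate v ..
  have "\<exists>u. u \<noteq> 0 \<and> (\<forall>j. conjugate (Suc j) (indicator E) u = 0)"
  proof (rule limit_of_commuting_projections[where v = v])
    show "bounded_linear (conjugate (Suc j) (indicator E))" for j
      using E by (simp add: conjugate_linear)
    show "conjugate (Suc j) (indicator E) (conjugate (Suc k) (indicator E) u)
        = conjugate (Suc k) (indicator E) (conjugate (Suc j) (indicator E) u)" for j k u
      using E by (simp add: conjugate_commute)
    show "conjugate (Suc j) (indicator E) (conjugate (Suc j) (indicator E) u) = conjugate (Suc j) (indicator E) u" for j u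
      using E by (simp add: conjugate_mult indicator_square)
    show "norm (u - conjugate (Suc j) (indicator E) u) \<le> norm u" for j u
    proof -
      \<comment> \<open>Under the isometry \<open>U ^^ Suc j\<close> the complementary projection
        becomes \<open>proj (- E)\<close>, a contraction.\<close>
      have "(U ^^ Suc j) (u - conjugate (Suc j) (indicator E) u) = proj (- E) ((U ^^ Suc j) u)"
        using linear_diff[OF bounded_linear.linear[OF Un_linear]] Un_conjugate
        by (metis E proj_Compl proj_def)
      moreover have "- E \<in> sets \<mu>"
        using sets.compl_sets[OF E] by (simp add: space Compl_eq_Diff_UNIV)
      ultimately show ?thesis using proj_norm[of "- E" "(U ^^ Suc j) u"] by (metis Un_norm)
    qed
    show "summable (\<lambda>j. norm (conjugate (Suc j) (indicator E) v))"
      unfolding nD using summ summable_iff_shift[of "\<lambda>k. norm (proj E ((U ^^ k) \<phi>))" N] by simp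
    show "(\<Sum>j. norm (conjugate (Suc j) (indicator E) v)) < norm v"
      unfolding nD using N \<open>norm v = norm \<phi>\<close> by simp
  qed
  then show ?thesis by (auto simp: outgoing_def)
qed

lemma outgoing_subspace:
  assumes E: "E \<in> sets \<mu>"
  shows "closed_csubspace (outgoing E)"
proof -
  have "outgoing E = (\<Inter>n. {v. conjugate (Suc n) (indicator E) v = 0})"
    by (auto simp: outgoing_def)
  moreover have "closed {v. conjugate n (indicator E) v = 0}" for n
    using E by (intro closed_Collect_eq linear_continuous_on conjugate_linear continuous_on_const) simp
  ultimately have "closed (outgoing E)" by (simp add: closed_INT)
  moreover have "conjugate n (indicator E) (v + w) = conjugate n (indicator E) v + conjugate n (indicator E) w" for n v w
    using E by (intro linear_add bounded_linear.linear conjugate_linear) simp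
  moreover have "conjugate n (indicator E) (c *\<^sub>C v) = c *\<^sub>C conjugate n (indicator E) v" for n c v
    using E by (simp add: conjugate_scale)
  moreover have "c *\<^sub>C 0 = (0::'h)" for c
    by (metis scaleC_of_real scaleC_scaleC scale_zero_left mult_zero_right of_real_0)
  ultimately show ?thesis
    using E by (simp add: closed_csubspace_def outgoing_def)
qed

text \<open>Otherwise \<open>proj E\<close> kills every outgoing vector, which makes
  \<open>outgoing E\<close> invariant under \<open>inv U\<close> too. By irreducibility it is the
  whole space, so \<open>proj E \<phi> = 0\<close>; but the squared norm of that vector is the
  measure of \<open>E\<close>.\<close>

lemma wandering_vector:
  assumes irr: "irreducible_rep \<mu> U \<pi>" and E: "E \<in> sets \<mu>" and pos: "emeasure \<mu> E \<noteq> 0"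
    and nz: "v \<in> outgoing E" "v \<noteq> 0"
  shows "\<exists>w\<in>outgoing E. proj E w = w \<and> w \<noteq> 0"
proof (rule ccontr)
  assume no: "\<not> ?thesis"
  have zero: "proj E w = 0" if "w \<in> outgoing E" for w
  proof -
    have "proj E w \<in> outgoing E"
      using conjugate_outgoing[OF E, of "indicator E" w 0] that E by (simp add: proj_def)
    moreover have "proj E (proj E w) = proj E w" using E by (simp add: proj_Int)
    ultimately show ?thesis using no by blast
  qed
  have "U ` outgoing E \<subseteq> outgoing E"
  proof clarify
    fix w assume w: "w \<in> outgoing E"
    have "(U ^^ Suc n) (U w) = (U ^^ Suc (Suc n)) w" for n
      by (simp only: funpow_Suc_right comp_apply)
    then show "U w \<in> outgoing E" using w E by (simp add: outgoing_iff del: funpow.simps)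
  qed
  moreover have "inv U ` outgoing E \<subseteq> outgoing E"
  proof clarify
    fix w assume w: "w \<in> outgoing E"
    \<comment> \<open>Applying \<open>inv U\<close> shifts the condition at \<open>n = 0\<close>
      into the definition of \<open>outgoing E\<close>; \<open>zero\<close> supplies it.\<close>
    have "proj E ((U ^^ n) w) = 0" for n
      using w zero[OF w] E by (cases n) (auto simp: outgoing_iff)
    then show "inv U w \<in> outgoing E"
      using E by (simp add: outgoing_iff funpow_Suc_right del: funpow.simps)
  qed
  moreover have "\<forall>f\<in>Linf. \<pi> f ` outgoing E \<subseteq> outgoing E"
    using conjugate_outgoing[OF E, where n = 0] by auto
  ultimately have "outgoing E = {0} \<or> outgoing E = UNIV"
    using irr outgoing_subspace[OF E] unfolding irreducible_rep_def by blast
  then have "proj E \<phi> = 0" using nz zero by blast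
  then have "(\<integral>x. (cmod (indicator E x))\<^sup>2 \<partial>\<mu>) = 0"
    using pi_phi_norm[of "indicator E"] E by (simp add: proj_def)
  moreover have "(\<lambda>x. (cmod (indicator E x))\<^sup>2) = indicator E" by (auto simp: indicator_def)
  ultimately have "measure \<mu> E = 0" using E by simp
  then show False using pos by (simp add: emeasure_eq_measure)
qed

text \<open>As \<open>u\<close> lies in the range of \<open>proj E\<close>, self-adjointness moves
  the projection to the other side, where it gives 0.\<close>

lemma wandering_orthogonal:
  assumes E: "E \<in> sets \<mu>" and "w \<in> outgoing E" and "proj E u = u"
  shows "cinner ((U ^^ Suc n) w) u = 0"
proof -
  have "cinner ((U ^^ Suc n) w) u = cinner (proj E ((U ^^ Suc n) w)) u"
    using proj_adj[OF E, of "(U ^^ Suc n) w" u] assms(3) by (simp del: funpow.simps)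
  then show ?thesis using assms by (simp add: outgoing_iff)
qed

text \<open>The part of the wandering subspace concentrated on \<open>A\<close> generates an
  invariant set \<open>S\<close> containing \<open>proj A w\<close>. The vector
  \<open>proj (- A) w\<close> is orthogonal to \<open>S\<close>: to the level 0 part by disjoint
  supports, to all other levels by wandering. If it is nonzero, irreducibility forces
  \<open>S\<close> to be zero.\<close>

lemma wandering_dichotomy:
  assumes irr: "irreducible_rep \<mu> U \<pi>" and E: "E \<in> sets \<mu>" and A: "A \<in> sets \<mu>"
    and w: "w \<in> outgoing E" "proj E w = w"
  shows "proj A w = 0 \<or> proj (- A) w = 0"
proof (rule disjCI)
  assume nz: "proj (- A) w \<noteq> 0"
  have A': "- A \<in> sets \<mu>"
    using sets.compl_sets[OF A] by (simp add: space Compl_eq_Diff_UNIV)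
  define W where "W = {v \<in> outgoing E. proj E v = v \<and> proj (- A) v = 0}"
  define S where "S = (\<Union>n. (U ^^ n) ` W) \<union> (\<Union>n. (inv U ^^ n) ` W)"
  have conjW: "conjugate n f v \<in> W" if "v \<in> W" "f \<in> Linf" for n f v
    using that conjugate_outgoing[OF E] conjugate_commute[of "indicator E" f 0 n v]
      conjugate_commute[of "indicator (- A)" f 0 n v] E A' by (simp add: W_def proj_def)
  have S1: "U x \<in> S" if xS: "x \<in> S" for x
  proof -
    consider n v where "x = (U ^^ n) v" "v \<in> W" | n v where "x = (inv U ^^ n) v" "v \<in> W"
      using xS unfolding S_def by blast
    then show ?thesis
    proof cases
      case 1
      then have "U x = (U ^^ Suc n) v" by simp
      then show ?thesis using 1 unfolding S_def by blast
    next
      case 2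
      show ?thesis
      proof (cases n)
        case 0
        then have "U x = (U ^^ Suc 0) v" using 2 by simp
        then show ?thesis using 2 unfolding S_def by blast
      next
        case (Suc k)
        then have "U x = (inv U ^^ k) v" using 2 by simp
        then show ?thesis using 2 unfolding S_def by blast
      qed
    qed
  qed
  have S2: "inv U x \<in> S" if xS: "x \<in> S" for x
  proof -
    consider n v where "x = (inv U ^^ n) v" "v \<in> W" | n v where "x = (U ^^ n) v" "v \<in> W"
      using xS unfolding S_def by blast
    then show ?thesis
    proof cases
      case 1
      then have "inv U x = (inv U ^^ Suc n) v" by simp
      then show ?thesis using 1 unfolding S_def by blast
    next
      case 2
      show ?thesis
      proof (cases n)
        case 0
        then have "inv U x = (inv U ^^ Suc 0) v" using 2 by simp
        then show ?thesis using 2 unfolding S_def by blast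
      next
        case (Suc k)
        then have "inv U x = (U ^^ k) v" using 2 by simp
        then show ?thesis using 2 unfolding S_def by blast
      qed
    qed
  qed
  have S3: "\<pi> f x \<in> S" if xS: "x \<in> S" and f: "f \<in> Linf" for f x
  proof -
    consider n v where "x = (U ^^ n) v" "v \<in> W" | n v where "x = (inv U ^^ n) v" "v \<in> W"
      using xS unfolding S_def by blast
    then show ?thesis
    proof cases
      case 1
      then have "\<pi> f x = (U ^^ n) (conjugate n f v)" by (simp add: Un_conjugate)
      then show ?thesis using conjW[OF 1(2) f] unfolding S_def by blast
    next
      case 2
      then have "\<pi> f x = (inv U ^^ n) (conjugate 0 (f \<circ> (r ^^ n)) v)"
        by (simp add: covariance_inv_Un f)
      then show ?thesis using conjW[OF 2(2) comp_rn[OF f], of 0] unfolding S_def by blast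
    qed
  qed
  define u where "u = proj (- A) w"
  have u: "u \<in> outgoing E" "proj E u = u"
    using conjugate_outgoing[OF E, of "indicator (- A)" w 0] w
      proj_commute[OF E, of "indicator (- A)" w] A' by (simp_all add: u_def proj_def)
  have perp: "cinner u x = 0" if xS: "x \<in> S" for x
  proof -
    consider n v where "x = (U ^^ n) v" "v \<in> W" | n v where "x = (inv U ^^ n) v" "v \<in> W"
      using xS unfolding S_def by blast
    then show ?thesis
    proof cases
      case 1
      show ?thesis
      proof (cases n)
        case 0
        then show ?thesis using 1 A' by (simp add: u_def proj_adj W_def)
      next
        case (Suc k)
        then have "cinner x u = 0"
          using wandering_orthogonal[OF E, of v u k] 1 u by (simp add: W_def)
        then show ?thesis by (subst cinner_commute) simp
      qed
    next
      case 2
      \<comment> \<open>For negative powers unitarity moves the power onto \<open>u\<close>, which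
        is itself wandering.\<close>
      have eq: "cinner u x = cinner ((U ^^ n) u) v"
        using Un_cinner[of n u x] 2 by simp
      show ?thesis
      proof (cases n)
        case 0
        then show ?thesis using 2 A' by (simp add: u_def proj_adj W_def)
      next
        case (Suc k)
        then show ?thesis
          unfolding eq using wandering_orthogonal[OF E, of u v k] 2 u by (simp add: W_def)
      qed
    qed
  qed
  have "proj A w \<in> W"
  proof -
    have "proj (- A) (proj A w) = 0" using A by (simp add: proj_Compl proj_Int)
    then show ?thesis
      using conjugate_outgoing[OF E, of "indicator A" w 0] w A
        proj_commute[OF E, of "indicator A" w] by (simp add: W_def proj_def)
  qed
  then have "proj A w \<in> S" unfolding S_def by (auto intro!: exI[of _ 0] bexI)
  then show "proj A w = 0"
    using invariant_subset_zero[OF irr S1 S2 S3, where u = u] nz perp by (auto simp: u_def)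
qed

text \<open>Approximate \<open>w\<close> by \<open>v = (inv U ^^ n) (\<pi> f \<phi>)\<close> within
  half its norm. If \<open>proj A\<close> fixes \<open>w\<close>, then \<open>proj A v\<close> keeps
  at least half of \<open>norm w\<close>, while boundedness of \<open>f\<close> and invariance of
  \<open>\<mu>\<close> bound its squared norm by a multiple of the measure of
  \<open>A\<close>.\<close>

lemma proj_measure_lower:
  assumes "w \<noteq> 0"
  shows "\<exists>\<delta>>0. \<forall>A\<in>sets \<mu>. proj A w = w \<longrightarrow> \<delta> \<le> measure \<mu> A"
proof -
  have "w \<in> closure {(inv U ^^ n) (\<pi> f \<phi>) | n f. f \<in> Linf}"
    by (simp only: dense UNIV_I)
  then have "\<forall>e>0. \<exists>y\<in>{(inv U ^^ n) (\<pi> f \<phi>) | n f. f \<in> Linf}. dist y w < e"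
    by (simp only: closure_approachable)
  moreover have "0 < norm w / 2" using assms by simp
  ultimately have "\<exists>y\<in>{(inv U ^^ n) (\<pi> f \<phi>) | n f. f \<in> Linf}. dist y w < norm w / 2"
    by blast
  then obtain n f where f: "f \<in> Linf" and d: "norm ((inv U ^^ n) (\<pi> f \<phi>) - w) < norm w / 2"
    by (auto simp: dist_norm)
  define v where "v = (inv U ^^ n) (\<pi> f \<phi>)"
  obtain C where C: "AE x in \<mu>. norm (f x) \<le> C" using f by (auto simp: L_infinity_def)
  have bound: "(norm (proj A v))\<^sup>2 \<le> C\<^sup>2 * measure \<mu> A" if A: "A \<in> sets \<mu>" for A
  proof -
    define g where "g = (indicator A \<circ> (r ^^ n) :: 'a \<Rightarrow> complex)"
    have g: "g \<in> Linf" using A by (simp add: g_def comp_rn)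
    have "norm (proj A v) = norm (\<pi> g (\<pi> f \<phi>))"
      using covariance_inv_Un[of "indicator A" n "\<pi> f \<phi>"] A
      by (simp add: v_def proj_def inv_Un_norm g_def del: comp_apply)
    also have "\<pi> g (\<pi> f \<phi>) = \<pi> (\<lambda>x. g x * f x) \<phi>" using g f by (simp add: pi_mult)
    finally have "(norm (proj A v))\<^sup>2 = (\<integral>x. (cmod (g x * f x))\<^sup>2 \<partial>\<mu>)"
      using g f by (simp add: pi_phi_norm L_infinity_mult)
    also have "\<dots> \<le> (\<integral>x. C\<^sup>2 * indicator A ((r ^^ n) x) \<partial>\<mu>)"
    proof (rule integral_mono_AE)
      show "integrable \<mu> (\<lambda>x. (cmod (g x * f x))\<^sup>2)"
      proof -
        have "(\<lambda>x. (g x * f x) * cnj (g x * f x)) \<in> Linf"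
          using g f by (intro L_infinity_mult L_infinity_cnj)
        from integrable_norm[OF L_infinity_integrable[OF this]]
        show ?thesis by (simp add: norm_mult power2_eq_square)
      qed
      show "integrable \<mu> (\<lambda>x. C\<^sup>2 * indicator A ((r ^^ n) x))"
        using A rn_meas[of n] by (intro integrable_mult_right integrable_const_bound[of _ 1]) (auto simp: indicator_def)
      show "AE x in \<mu>. (cmod (g x * f x))\<^sup>2 \<le> C\<^sup>2 * indicator A ((r ^^ n) x)"
        using C by eventually_elim (auto simp: g_def indicator_def intro!: power_mono)
    qed
    also have "\<dots> = C\<^sup>2 * (\<integral>x. indicator A x \<partial>distr \<mu> \<mu> (r ^^ n))"
      using A by (subst integral_distr[OF rn_meas]) auto
    also have "\<dots> = C\<^sup>2 * measure \<mu> A" using A by (simp add: rn_distr)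
    finally show ?thesis .
  qed
  show ?thesis
  \<comment> \<open>The summand 1 keeps the denominator positive even if \<open>C\<close> is
    0.\<close>
  proof (intro exI[of _ "(norm w / 2)\<^sup>2 / (C\<^sup>2 + 1)"] conjI ballI impI)
    show "0 < (norm w / 2)\<^sup>2 / (C\<^sup>2 + 1)"
      using assms by (intro divide_pos_pos) (auto simp: add_nonneg_pos)
    fix A assume A: "A \<in> sets \<mu>" and w: "proj A w = w"
    have "proj A (w - v) = w - proj A v"
      using linear_diff[OF bounded_linear.linear[OF proj_linear[OF A]]] w by simp
    then have "norm (w - proj A v) \<le> norm (w - v)" using proj_norm[OF A] by metis
    also have "\<dots> < norm w / 2" using d by (simp add: v_def norm_minus_commute)
    finally have "norm w / 2 \<le> norm (proj A v)"
      using norm_triangle_ineq2[of w "proj A v"] by linarith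
    then have "(norm w / 2)\<^sup>2 \<le> (norm (proj A v))\<^sup>2" by (intro power_mono) auto
    also have "\<dots> \<le> C\<^sup>2 * measure \<mu> A" by (rule bound[OF A])
    also have "\<dots> \<le> measure \<mu> A * (C\<^sup>2 + 1)" by (simp add: algebra_simps)
    finally show "(norm w / 2)\<^sup>2 / (C\<^sup>2 + 1) \<le> measure \<mu> A"
      by (subst pos_divide_le_eq) (auto simp: add_nonneg_pos)
  qed
qed

end

subsection \<open>Atoms of ergodic strongly invariant measures\<close>

text \<open>\<open>Q\<close> acts as an ultrafilter on Borel sets whose members have mass at least
  \<open>\<delta>\<close>. At each scale it contains a small ball; the intersection of these balls
  has diameter 0 and, by continuity from above, mass at least \<open>\<delta>\<close>.\<close>

lemma point_mass_of_ultrafilter: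
  fixes M :: "'a::metric_space measure"
  assumes cpt: "compact (UNIV :: 'a set)" and sets: "sets M = sets borel" and "finite_measure M"
    and \<delta>: "0 < \<delta>" and lower: "\<And>A. A \<in> sets M \<Longrightarrow> Q A \<Longrightarrow> \<delta> \<le> measure M A"
    and Int: "\<And>A B. A \<in> sets M \<Longrightarrow> B \<in> sets M \<Longrightarrow> Q A \<Longrightarrow> Q B \<Longrightarrow> Q (A \<inter> B)"
    and ultra: "\<And>A. A \<in> sets M \<Longrightarrow> Q A \<or> Q (- A)"
  shows "\<exists>x. \<delta> \<le> measure M {x}"
proof -
  interpret finite_measure M by fact
  have cb: "cball x e \<in> sets M" and ncb: "- cball x e \<in> sets M" for x e
    by (simp_all add: sets)
  have empty: "\<not> Q {}" using lower[of "{}"] \<delta> by auto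
  then have univ: "Q UNIV" using ultra[of "{}"] by auto
  have fin: "(\<Inter>i\<in>I. A i) \<in> sets M \<and> Q (\<Inter>i\<in>I. A i)"
    if "finite I" "\<And>i. i \<in> I \<Longrightarrow> A i \<in> sets M" "\<And>i. i \<in> I \<Longrightarrow> Q (A i)" for I :: "'i set" and A
    using that
  proof (induction I)
    case empty
    then show ?case using univ by (simp add: sets)
  next
    case (insert i I)
    then show ?case using Int[of "A i" "\<Inter>i\<in>I. A i"] by auto
  qed
  have "\<exists>x. Q (cball x (inverse (Suc n)))" for n
  proof (rule ccontr)
    assume "\<nexists>x. Q (cball x (inverse (Suc n)))"
    \<comment> \<open>By total boundedness finitely many of these complements have empty
      intersection, yet \<open>Q\<close> is stable under finite intersections and fails for the
      empty set.\<close>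
    then have no: "Q (- cball x (inverse (Suc n)))" for x using ultra[OF cb] by blast
    have "\<forall>e>0. \<exists>k. finite k \<and> UNIV \<subseteq> (\<Union>x\<in>k. ball (x::'a) e)"
      using cpt unfolding compact_eq_totally_bounded by (rule conjunct2)
    moreover have "0 < inverse (real (Suc n))" by simp
    ultimately obtain k where k: "finite k" "UNIV \<subseteq> (\<Union>x\<in>k. ball (x::'a) (inverse (Suc n)))"
      by blast
    have "Q (\<Inter>x\<in>k. - cball x (inverse (Suc n)))"
      using fin[OF k(1), of "\<lambda>x. - cball x (inverse (Suc n))"] ncb no by blast
    moreover have "(\<Inter>x\<in>k. - cball x (inverse (Suc n))) = {}"
    proof -
      have "\<exists>x\<in>k. y \<in> cball x (inverse (Suc n))" for y
        using k(2) ball_subset_cball by blast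
      then show ?thesis by blast
    qed
    ultimately show False using empty by simp
  qed
  then obtain c where c: "Q (cball (c n) (inverse (Suc n)))" for n by metis
  define B where "B n = (\<Inter>i\<in>{..n}. cball (c i) (inverse (Suc i)))" for n
  have B: "B n \<in> sets M" "Q (B n)" for n
    unfolding B_def using fin[of "{..n}" "\<lambda>i. cball (c i) (inverse (Suc i))"] cb c by auto
  have "decseq B" by (auto simp: B_def decseq_def)
  then have "(\<lambda>n. measure M (B n)) \<longlonglongrightarrow> measure M (\<Inter>n. B n)"
    using B by (intro finite_Lim_measure_decseq) auto
  then have m: "\<delta> \<le> measure M (\<Inter>n. B n)"
    by (rule LIMSEQ_le_const) (use lower B in auto)
  have "(\<Inter>n. B n) \<noteq> {}"
  proof
    assume "(\<Inter>n. B n) = {}"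
    then show False using m \<delta> by (simp only: measure_empty)
  qed
  then obtain x where x: "x \<in> (\<Inter>n. B n)" by blast
  have "y = x" if "y \<in> (\<Inter>n. B n)" for y
  proof -
    have d: "dist x y \<le> 2 * inverse (real (Suc n))" for n
    proof -
      have "x \<in> cball (c n) (inverse (Suc n))" "y \<in> cball (c n) (inverse (Suc n))"
        using x that by (auto simp: B_def)
      then show ?thesis using dist_triangle3[of x y "c n"] by (simp add: dist_commute)
    qed
    have "(\<lambda>n. 2 * inverse (real (Suc n))) \<longlonglongrightarrow> 2 * 0"
      by (intro tendsto_intros LIMSEQ_inverse_real_of_nat)
    then have "dist x y \<le> 2 * 0"
      by (rule LIMSEQ_le_const) (use d in auto)
    then show "y = x" by simp
  qed
  then have "(\<Inter>n. B n) = {x}" using x by blast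
  then show ?thesis using m by auto
qed

text \<open>The set \<open>F\<close> of atoms of maximal mass is finite and mapped into itself, and
  strong invariance gives its image points a single preimage each. So \<open>r\<close> permutes
  \<open>F\<close>, ergodicity gives \<open>F\<close> full measure, and the QMF average over a
  one-point fibre is a single value of the squared modulus of \<open>m\<close>.\<close>

lemma abs_eq_1_of_atom:
  fixes M :: "'a::metric_space measure" and r :: "'a \<Rightarrow> 'a" and m :: "'a \<Rightarrow> complex"
  assumes sets: "sets M = sets borel" and fin: "\<And>x. finite (r -` {x})"
    and si: "strongly_invariant r M" and qmf: "qmf_filter r M m" and erg: "ergodic_map M r"
    and atom: "measure M {z} \<noteq> 0"
  shows "AE x in M. cmod (m x) = 1"
proof -
  interpret finite_measure M using si by (simp add: strongly_invariant_def)
  have space: "space M = UNIV" using sets_eq_imp_space_eq[OF sets] by simp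
  have sing: "{x} \<in> sets M" for x by (simp add: sets)
  have r: "r \<in> measurable M M" and distr: "distr M M r = M"
    using erg by (simp_all add: ergodic_map_def)
  have pre: "measure M (r -` A) = measure M A" if "A \<in> sets M" for A
    using measure_distr[OF r that] distr by (simp add: space)
  have preset: "r -` A \<in> sets M" if "A \<in> sets M" for A
    using measurable_sets[OF r that] by (simp add: space)
  define H where "H d = {x. d \<le> measure M {x}}" for d
  have finH: "finite (H d)" if "0 < d" for d
  proof (rule ccontr)
    assume "infinite (H d)"
    then obtain F where F: "F \<subseteq> H d" "finite F" "card F = nat \<lceil>measure M UNIV / d\<rceil> + 1"
      using infinite_arbitrarily_large by blast
    have "real (card F) * d \<le> (\<Sum>x\<in>F. measure M {x})"
      using F(1) sum_bounded_below[of F d "\<lambda>x. measure M {x}"] by (auto simp: H_def)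
    also have "\<dots> = measure M F"
      using F(2) sing by (intro finite_measure_eq_sum_singleton[symmetric]) auto
    also have "\<dots> \<le> measure M UNIV" using bounded_measure[of F] by (simp add: space)
    finally have "real (card F) \<le> measure M UNIV / d" using that by (simp add: field_simps)
    then show False using F(3) by linarith
  qed
  \<comment> \<open>Only points at least as heavy as \<open>z\<close> can attain the maximum; there
    are finitely many because the total mass is finite.\<close>
  define c where "c = Max ((\<lambda>x. measure M {x}) ` H (measure M {z}))"
  have zpos: "0 < measure M {z}" using atom by (simp add: zero_less_measure_iff)
  have zH: "z \<in> H (measure M {z})" by (simp add: H_def)
  note finz = finite_imageI[OF finH[OF zpos], of "\<lambda>x. measure M {x}"]
  have max: "measure M {x} \<le> c" for x
  proof (cases "x \<in> H (measure M {z})")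
    case True
    then show ?thesis unfolding c_def by (intro Max_ge[OF finz]) auto
  next
    case False
    then have "measure M {x} \<le> measure M {z}" by (simp add: H_def)
    also have "\<dots> \<le> c" unfolding c_def using zH by (intro Max_ge[OF finz]) auto
    finally show ?thesis .
  qed
  have cpos: "0 < c" using zpos max[of z] by linarith
  define F where "F = {x. measure M {x} = c}"
  have "F \<subseteq> H c" by (auto simp: F_def H_def)
  then have finF: "finite F" using finH[OF cpos] finite_subset by blast
  have "c \<in> (\<lambda>x. measure M {x}) ` H (measure M {z})"
    unfolding c_def using zH by (intro Max_in[OF finz]) auto
  then obtain y0 where y0: "y0 \<in> F" by (auto simp: F_def)
  have rF: "r y \<in> F" if "y \<in> F" for y
  proof -
    \<comment> \<open>By invariance the right-hand side is the mass of \<open>{r y}\<close>, so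
      maximality passes from \<open>y\<close> to \<open>r y\<close>.\<close>
    have "measure M {y} \<le> measure M (r -` {r y})"
      using preset[OF sing] by (intro finite_measure_mono) auto
    then show ?thesis using that max[of "r y"] pre[OF sing, of "r y"] by (simp add: F_def)
  qed
  have fibre: "r -` {r y} = {y}" if y: "y \<in> F" for y
  proof -
    have ind: "(\<integral>x. indicator A x \<partial>M) = complex_of_real (measure M A)" if "A \<in> sets M" for A
    proof -
      have "(\<lambda>x. indicator A x :: complex) = (\<lambda>x. complex_of_real (indicator A x))"
        by (auto simp: indicator_def)
      then have "(\<integral>x. indicator A x \<partial>M) = complex_of_real (\<integral>x. indicator A x \<partial>M)"
        by (simp only: integral_complex_of_real)
      then show ?thesis using that by simp
    qed
    have L: "(indicator {y} :: 'a \<Rightarrow> complex) \<in> L_infinity M" by (simp add: sing)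
    have avg: "fibre_avg r (indicator {y}) x = (1 / of_nat (card (r -` {r y}))) * (indicator {r y} x :: complex)" for x
    proof (cases "x = r y")
      case True
      have "(\<Sum>u\<in>r -` {r y}. indicator {y} u) = (\<Sum>u\<in>{y}. indicator {y} u :: complex)"
        using fin by (intro sum.mono_neutral_right) (auto simp: indicator_def)
      then show ?thesis using True by (simp add: fibre_avg_def)
    next
      case False
      then have "(\<Sum>u\<in>r -` {x}. indicator {y} u :: complex) = 0"
        by (intro sum.neutral) (auto simp: indicator_def)
      then show ?thesis using False by (simp add: fibre_avg_def)
    qed
    have "(\<integral>x. indicator {y} x \<partial>M) = (\<integral>x. fibre_avg r (indicator {y} :: 'a \<Rightarrow> complex) x \<partial>M)"
      using si L by (simp add: strongly_invariant_def)
    \<comment> \<open>Both masses equal \<open>c > 0\<close>, so the cardinality of the fibre must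
      be 1.\<close>
    then have "of_real (measure M {y}) = (1 / of_nat (card (r -` {r y}))) * complex_of_real (measure M {r y})"
      using ind[OF sing] by (simp add: avg)
    then have "card (r -` {r y}) = 1"
      using y rF[OF y] cpos by (auto simp: F_def divide_simps split: if_splits)
    then obtain u where "r -` {r y} = {u}" by (auto simp: card_1_singleton_iff)
    then show ?thesis by auto
  qed
  have "inj_on r F"
  proof (rule inj_onI)
    fix x y assume "x \<in> F" "y \<in> F" "r x = r y"
    then have "{x} = {y}" using fibre by metis
    then show "x = y" by simp
  qed
  then have img: "r ` F = F" using finF rF by (intro endo_inj_surj) auto
  have "r -` F = F"
  proof
    show "F \<subseteq> r -` F" using rF by auto
    show "r -` F \<subseteq> F"
    proof
      fix x assume "x \<in> r -` F"
      then obtain y where "y \<in> F" "r x = r y" using img by (metis imageE vimageE)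
      then have "x \<in> {y}" using fibre by blast
      then show "x \<in> F" using \<open>y \<in> F\<close> by simp
    qed
  qed
  moreover have Fs: "F \<in> sets M" using finF by (simp add: sets finite_imp_closed)
  ultimately have "F \<in> null_sets M \<or> space M - F \<in> null_sets M"
    using erg by (simp add: ergodic_map_def space)
  moreover have "F \<notin> null_sets M"
  proof
    assume "F \<in> null_sets M"
    then have "measure M {y0} = 0"
      using null_sets_subset[of F M "{y0}"] sing y0 measure_eq_0_null_sets by blast
    then show False using y0 cpos by (simp add: F_def)
  qed
  ultimately have "AE x in M. x \<in> F" using AE_not_in[of "space M - F" M] by (auto simp: space)
  moreover have "cmod (m y) = 1" if y: "y \<in> F" for y
  proof -
    have "AE x in M. fibre_avg r (\<lambda>y. (cmod (m y))\<^sup>2) x = 1" using qmf by (simp add: qmf_filter_def)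
    then obtain N where N: "N \<in> null_sets M" "{x \<in> space M. fibre_avg r (\<lambda>y. (cmod (m y))\<^sup>2) x \<noteq> 1} \<subseteq> N"
      by (auto elim!: AE_E simp: null_sets_def)
    \<comment> \<open>The QMF identity holds only almost everywhere, but an atom cannot lie in the
      exceptional null set.\<close>
    have "r y \<notin> N"
    proof
      assume "r y \<in> N"
      then have "measure M {r y} = 0"
        using N(1) null_sets_subset[of N M "{r y}"] sing measure_eq_0_null_sets by blast
      then show False using rF[OF y] cpos by (simp add: F_def)
    qed
    then have "fibre_avg r (\<lambda>y. (cmod (m y))\<^sup>2) (r y) = 1" using N(2) by (auto simp: space)
    then have "(cmod (m y))\<^sup>2 = 1" by (simp add: fibre_avg_def fibre[OF y])
    then show ?thesis by (simp add: power2_eq_1_iff) (metis norm_ge_zero not_one_le_zero neg_0_le_iff_le order_trans)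
  qed
  ultimately show ?thesis by (auto elim: eventually_mono)
qed

subsection \<open>Reducibility\<close>

text \<open>The hypothesis \<open>|m| \<noteq> 1\<close> makes Jensen's inequality
  \<open>\<integral> ln |m|\<^sup>2 d\<mu> < ln (\<integral> |m|\<^sup>2 d\<mu>)\<close> strict.\<close>

lemma integral_ln_neg:
  assumes si: "strongly_invariant r M" and qmf: "qmf_filter r M m"
    and nt: "\<not> (AE x in M. cmod (m x) = 1)" and nz: "AE x in M. m x \<noteq> 0"
    and int: "integrable M (\<lambda>x. ln ((cmod (m x))\<^sup>2))"
  shows "(\<integral>x. ln ((cmod (m x))\<^sup>2) \<partial>M) < 0"
proof -
  interpret finite_measure M using si by (simp add: strongly_invariant_def)
  have m: "m \<in> L_infinity M" using qmf by (simp add: qmf_filter_def)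
  have mm: "(\<lambda>x. m x * cnj (m x)) \<in> L_infinity M"
    by (intro L_infinity_mult L_infinity_cnj m)
  have mm_eq: "m x * cnj (m x) = complex_of_real ((cmod (m x))\<^sup>2)" for x
    by (simp only: complex_norm_square)
  have int2: "integrable M (\<lambda>x. (cmod (m x))\<^sup>2)"
    using L_infinity_integrable[OF mm] unfolding mm_eq by (simp only: complex_of_real_integrable_eq)
  have avg: "fibre_avg r (\<lambda>x. complex_of_real ((cmod (m x))\<^sup>2))
      = (\<lambda>x. complex_of_real (fibre_avg r (\<lambda>x. (cmod (m x))\<^sup>2) x))"
    by (simp add: fibre_avg_def fun_eq_iff)
  have i2: "integrable M (\<lambda>x. complex_of_real (fibre_avg r (\<lambda>x. (cmod (m x))\<^sup>2) x))"
    and e2: "(\<integral>x. complex_of_real ((cmod (m x))\<^sup>2) \<partial>M)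
      = (\<integral>x. complex_of_real (fibre_avg r (\<lambda>x. (cmod (m x))\<^sup>2) x) \<partial>M)"
    using si mm unfolding strongly_invariant_def mm_eq avg[symmetric] by blast+
  have "(\<integral>x. complex_of_real (fibre_avg r (\<lambda>x. (cmod (m x))\<^sup>2) x) \<partial>M) = (\<integral>x. 1 \<partial>M)"
    using qmf i2 by (intro integral_cong_AE) (auto simp: qmf_filter_def)
  then have "complex_of_real (\<integral>x. (cmod (m x))\<^sup>2 \<partial>M) = complex_of_real (measure M (space M))"
    using e2 by (simp only: integral_complex_of_real) (simp add: of_real_def)
  then have mean: "(\<integral>x. (cmod (m x))\<^sup>2 \<partial>M) = measure M (space M)"
    by (simp only: of_real_eq_iff)
  \<comment> \<open>The inequality \<open>ln t \<le> t - 1\<close>, strict except at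
    \<open>t = 1\<close>, takes the place of a general Jensen inequality. As the mean in
    \<open>mean\<close> equals the total mass, the terms other than the logarithm cancel on
    integration.\<close>
  define g where "g x = (cmod (m x))\<^sup>2 - 1 - ln ((cmod (m x))\<^sup>2)" for x
  have ig: "integrable M g" unfolding g_def using int2 int by simp
  have gpos: "AE x in M. 0 \<le> g x"
    using nz by eventually_elim (simp add: g_def ln_le_minus_one)
  have Ig: "(\<integral>x. g x \<partial>M) = - (\<integral>x. ln ((cmod (m x))\<^sup>2) \<partial>M)"
    unfolding g_def using int2 int mean by simp
  have "(\<integral>x. g x \<partial>M) \<noteq> 0"
  proof
    assume "(\<integral>x. g x \<partial>M) = 0"
    then have "AE x in M. g x = 0" using integral_nonneg_eq_0_iff_AE[OF ig gpos] by simp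
    then have "AE x in M. cmod (m x) = 1"
      using nz
    proof eventually_elim
      case (elim x)
      then have "(cmod (m x))\<^sup>2 = 1"
        by (intro ln_eq_minus_one) (auto simp: g_def)
      then show ?case using norm_ge_zero[of "m x"] by (simp add: power2_eq_1_iff)
    qed
    then show False using nt by simp
  qed
  then show ?thesis using Ig integral_nonneg_AE[OF gpos] by linarith
qed

context wavelet_rep
begin

text \<open>The squared norm is the integral over \<open>E\<close> of the squared modulus of the
  product in \<open>Un_phi\<close>. The logarithmic bound makes it at most
  \<open>exp (- \<epsilon>) ^ n * (norm \<phi>)\<^sup>2\<close>, and the square root gives a
  geometric series.\<close>

lemma summable_proj_Un:
  assumes E: "E \<in> sets \<mu>" and nz: "AE x in \<mu>. m x \<noteq> 0" and eps: "0 < \<epsilon>"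
    and decay: "\<And>x n. x \<in> E \<Longrightarrow> (\<Sum>k<n. ln ((cmod (m ((r ^^ k) x)))\<^sup>2) + \<epsilon>) \<le> 0"
  shows "summable (\<lambda>k. norm (proj E ((U ^^ k) \<phi>)))"
proof (rule summable_comparison_test'[of "\<lambda>k. exp (- \<epsilon> / 2) ^ k * norm \<phi>" 0])
  show "summable (\<lambda>k. exp (- \<epsilon> / 2) ^ k * norm \<phi>)"
    using eps by (intro summable_mult2 summable_geometric) simp
  fix n :: nat
  define M where "M x = (\<Prod>k<n. m ((r ^^ k) x))" for x
  have M: "M \<in> Linf"
    unfolding M_def using comp_rn[OF m_Linf] by (intro L_infinity_prod) (simp add: comp_def)
  have iM: "(\<lambda>x. indicator E x * M x) \<in> Linf" using E M by (simp add: L_infinity_mult)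
  \<comment> \<open>Rewriting the factors as \<open>exp (ln t)\<close> requires \<open>t > 0\<close>
    along the whole orbit; invariance transports nonvanishing to each iterate.\<close>
  have ae: "AE x in \<mu>. \<forall>k. m ((r ^^ k) x) \<noteq> 0"
    unfolding AE_all_countable
  proof
    fix k
    have "AE x in distr \<mu> \<mu> (r ^^ k). m x \<noteq> 0" using nz unfolding rn_distr .
    then show "AE x in \<mu>. m ((r ^^ k) x) \<noteq> 0" by (rule AE_distrD[OF rn_meas])
  qed
  have "proj E ((U ^^ n) \<phi>) = \<pi> (\<lambda>x. indicator E x * M x) \<phi>"
    using E M by (simp add: Un_phi proj_def pi_mult M_def[abs_def])
  then have "(norm (proj E ((U ^^ n) \<phi>)))\<^sup>2 = (\<integral>x. (cmod (indicator E x * M x))\<^sup>2 \<partial>\<mu>)"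
    using pi_phi_norm[OF iM] by simp
  also have "\<dots> \<le> (\<integral>x. exp (- \<epsilon>) ^ n \<partial>\<mu>)"
  proof (rule integral_mono_AE)
    have "(\<lambda>x. (indicator E x * M x) * cnj (indicator E x * M x)) \<in> Linf"
      by (rule L_infinity_mult[OF iM L_infinity_cnj[OF iM]])
    from integrable_norm[OF L_infinity_integrable[OF this]]
    show "integrable \<mu> (\<lambda>x. (cmod (indicator E x * M x))\<^sup>2)"
      by (simp add: norm_mult power2_eq_square)
    show "AE x in \<mu>. (cmod (indicator E x * M x))\<^sup>2 \<le> exp (- \<epsilon>) ^ n"
      using ae
    proof eventually_elim
      case (elim x)
      show ?case
      proof (cases "x \<in> E")
        case True
        have "(cmod (M x))\<^sup>2 = (\<Prod>k<n. (cmod (m ((r ^^ k) x)))\<^sup>2)"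
          by (simp add: M_def prod_norm[symmetric] prod_power_distrib)
        also have "\<dots> = (\<Prod>k<n. exp (ln ((cmod (m ((r ^^ k) x)))\<^sup>2)))"
          using elim by (intro prod.cong) auto
        also have "\<dots> = exp (\<Sum>k<n. ln ((cmod (m ((r ^^ k) x)))\<^sup>2))"
          by (simp add: exp_sum)
        also have "\<dots> \<le> exp (of_nat n * (- \<epsilon>))"
          using decay[OF True, of n] by (simp add: sum.distrib)
        also have "\<dots> = exp (- \<epsilon>) ^ n" by (rule exp_of_nat_mult)
        finally show ?thesis using True by simp
      qed simp
    qed
  qed simp
  also have "\<dots> = exp (- \<epsilon>) ^ n * (norm \<phi>)\<^sup>2" by (simp add: phi_norm space)
  also have "exp (- \<epsilon>) = (exp (- \<epsilon> / 2))\<^sup>2" by (simp add: power2_eq_square exp_add[symmetric])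
  also have "((exp (- \<epsilon> / 2))\<^sup>2) ^ n * (norm \<phi>)\<^sup>2 = (exp (- \<epsilon> / 2) ^ n * norm \<phi>)\<^sup>2"
    by (simp add: power_mult_distrib power_mult[symmetric] mult.commute)
  finally have "norm (proj E ((U ^^ n) \<phi>)) \<le> exp (- \<epsilon> / 2) ^ n * norm \<phi>"
    by (rule power2_le_imp_le) simp
  then show "norm (norm (proj E ((U ^^ n) \<phi>))) \<le> exp (- \<epsilon> / 2) ^ n * norm \<phi>" by simp
qed

end

theorem theorem3:
  fixes \<mu> :: "'a::metric_space measure"
    and r :: "'a \<Rightarrow> 'a"
    and m\<^sub>0 :: "'a \<Rightarrow> complex"
    and U :: "'h::chilbert_space \<Rightarrow> 'h"
    and \<pi> :: "('a \<Rightarrow> complex) \<Rightarrow> 'h \<Rightarrow> 'h"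
    and \<phi> :: 'h
  assumes "compact (UNIV :: 'a set)"
    and "r \<in> borel_measurable borel"
    and "surj r"
    and "\<And>x. finite (r -` {x})"
    and "sets \<mu> = sets borel"
    and "strongly_invariant r \<mu>"
    and "qmf_filter r \<mu> m\<^sub>0"
    and "ergodic_map \<mu> r"
    and "\<not> (AE x in \<mu>. cmod (m\<^sub>0 x) = 1)"
    and "emeasure \<mu> {x. m\<^sub>0 x = 0} = 0"
    and "integrable \<mu> (\<lambda>x. ln ((cmod (m\<^sub>0 x))\<^sup>2))"
    and "wavelet_representation r \<mu> m\<^sub>0 U \<pi> \<phi>"
  shows "reducible_rep \<mu> U \<pi>"
proof
  assume irr: "irreducible_rep \<mu> U \<pi>"
  interpret finite_measure \<mu> using assms(6) by (simp add: strongly_invariant_def)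
  have sp: "space \<mu> = UNIV" using sets_eq_imp_space_eq[OF assms(5)] by simp
  interpret wavelet_rep \<mu> r m\<^sub>0 U \<pi> \<phi>
    using assms(7,8,12) sp by unfold_locales (auto simp: ergodic_map_def qmf_filter_def)
  have [measurable]: "m\<^sub>0 \<in> borel_measurable \<mu>" using m_Linf by (simp add: L_infinity_def)
  have "{x. m\<^sub>0 x = 0} = {x \<in> space \<mu>. m\<^sub>0 x = 0}" by (simp add: sp)
  also have "\<dots> \<in> sets \<mu>" by measurable
  finally have nz: "AE x in \<mu>. m\<^sub>0 x \<noteq> 0"
    using assms(10) by (intro AE_I'[of "{x. m\<^sub>0 x = 0}"]) (auto simp: null_sets_def)
  have neg: "(\<integral>x. ln ((cmod (m\<^sub>0 x))\<^sup>2) \<partial>\<mu>) < 0" (is "?I < 0")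
    by (rule integral_ln_neg[OF assms(6,7,9) nz assms(11)])
  \<comment> \<open>The measure is not normalised. With \<open>c\<close> exceeding the total mass,
    the choice of \<open>\<epsilon>\<close> below uses up at most half of the negative
    integral.\<close>
  define c where "c = measure \<mu> UNIV + 1"
  have c: "0 < c" unfolding c_def by (intro add_nonneg_pos measure_nonneg zero_less_one)
  define \<epsilon> where "\<epsilon> = - ?I / (2 * c)"
  have eps: "0 < \<epsilon>" unfolding \<epsilon>_def using neg c by (intro divide_pos_pos) auto
  have "\<epsilon> * c = - ?I / 2" using c by (simp add: \<epsilon>_def)
  then have "?I + \<epsilon> * measure \<mu> UNIV < 0" using eps neg by (simp add: c_def distrib_left)
  then have "(\<integral>x. ln ((cmod (m\<^sub>0 x))\<^sup>2) + \<epsilon> \<partial>\<mu>) < 0"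
    using assms(11) by (simp add: sp mult.commute)
  then obtain E where E: "E \<in> sets \<mu>" "emeasure \<mu> E \<noteq> 0"
    "\<And>x n. x \<in> E \<Longrightarrow> (\<Sum>k<n. ln ((cmod (m\<^sub>0 ((r ^^ k) x)))\<^sup>2) + \<epsilon>) \<le> 0"
    using nonpositive_ergodic_sums[OF r_meas r_distr, of "\<lambda>x. ln ((cmod (m\<^sub>0 x))\<^sup>2) + \<epsilon>"] assms(11)
    by auto
  have "0 < measure \<mu> E" using E(2) by (simp add: emeasure_eq_measure zero_less_measure_iff)
  also have "\<dots> \<le> measure \<mu> UNIV" using bounded_measure[of E] by (simp add: sp)
  finally have "\<phi> \<noteq> 0" using phi_norm by auto
  then obtain v where v: "v \<in> outgoing E" "v \<noteq> 0"
    using outgoing_nonzero[OF E(1) summable_proj_Un[OF E(1) nz eps E(3)]] by blast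
  then obtain w where w: "w \<in> outgoing E" "proj E w = w" "w \<noteq> 0"
    using wandering_vector[OF irr E(1,2)] by blast
  obtain \<delta> where \<delta>: "0 < \<delta>" "\<And>A. A \<in> sets \<mu> \<Longrightarrow> proj A w = w \<Longrightarrow> \<delta> \<le> measure \<mu> A"
    using proj_measure_lower[OF w(3)] by blast
  \<comment> \<open>The ultrafilter consists of the Borel sets \<open>A\<close> on which
    \<open>w\<close> is concentrated, that is \<open>proj A w = w\<close>; the dichotomy supplies
    the ultrafilter property.\<close>
  have "\<exists>x. \<delta> \<le> measure \<mu> {x}"
  proof (rule point_mass_of_ultrafilter[OF assms(1,5) finite_measure_axioms \<delta>])
    show "proj (A \<inter> B) w = w"
      if "A \<in> sets \<mu>" "B \<in> sets \<mu>" "proj A w = w" "proj B w = w" for A B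
      using that proj_Int[of A B w] by simp
    show "proj A w = w \<or> proj (- A) w = w" if A: "A \<in> sets \<mu>" for A
      using wandering_dichotomy[OF irr E(1) A w(1,2)] proj_Compl[OF A, of w] by auto
  qed
  then obtain z where "measure \<mu> {z} \<noteq> 0" using \<delta>(1) by force
  then show False
    using abs_eq_1_of_atom[OF assms(5,4,6,7,8)] assms(9) by blast
qed

end
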